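(* Let $\mathcal{A} \in \mathbb{R}^{I_1 \times J_1 \times K}$ and $\mathcal{B} \in \mathbb{R}^{K \times J_2 \times I_2}$ be two 3-order tensors, and let $\mathbf{A} \in \mathbb{R}^{R_1 \times J_1}$ and $\mathbf{B} \in \mathbb{R}^{R_2 \times J_2}$ be two matrices. Then $$(\mathcal{A} \times_2 \mathbf{A}) \boxtimes_2 (\mathcal{B} \times_2 \mathbf{B}) = (\mathcal{A} \boxtimes_2 \mathcal{B}) \times_2 (\mathbf{B} \otimes \mathbf{A}).$$
   Context: All dimensions are positive integers, and $[I]=\{1,\dots,I\}$. Multi-index (little-endian convention): for $i_1\in[I_1],\dots,i_N\in[I_N]$, $\overline{i_1 i_2\cdots i_N} = i_1+(i_2-1)I_1+(i_3-1)I_1I_2+\cdots+(i_N-1)I_1\cdots I_{N-1}\in[I_1\cdots I_N]$. In particular, for $j_1\in[J_1]$, $j_2\in[J_2]$, $\overline{j_1j_2}=j_1+(j_2-1)J_1$. Lateral slice: for a 3-order tensor $\mathcal{X}\in\mathbb{R}^{P\times J\times Q}$ and $j\in[J]$, the $j$-th lateral slice is the matrix $\mathcal{X}(j)=\mathcal{X}(:,j,:)\in\mathbb{R}^{P\times Q}$. Mode-2 product: for $\mathcal{X}\in\mathbb{R}^{P\times J\times Q}$ and $\mathbf{U}\in\mathbb{R}^{R\times J}$, $\mathcal{X}\times_2\mathbf{U}\in\mathbb{R}^{P\times R\times Q}$ is defined by $(\mathcal{X}\times_2\mathbf{U})(p,r,q)=\sum_{j=1}^{J}\mathcal{X}(p,j,q)\,\mathbf{U}(r,j)$.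 Mode-2 subchain product: for $\mathcal{A}\in\mathbb{R}^{I_1\times J_1\times K}$ and $\mathcal{B}\in\mathbb{R}^{K\times J_2\times I_2}$, $\mathcal{A}\boxtimes_2\mathcal{B}\in\mathbb{R}^{I_1\times J_1J_2\times I_2}$ is the tensor whose lateral slices are the ordinary matrix products $(\mathcal{A}\boxtimes_2\mathcal{B})(\overline{j_1j_2})=\mathcal{A}(j_1)\,\mathcal{B}(j_2)$ for $j_1\in[J_1]$, $j_2\in[J_2]$. Kronecker product: $\mathbf{B}\otimes\mathbf{A}$ is the usual Kronecker product, the block matrix with blocks $b_{ij}\mathbf{A}$; for $\mathbf{A}\in\mathbb{R}^{R_1\times J_1}$, $\mathbf{B}\in\mathbb{R}^{R_2\times J_2}$ its entries are $(\mathbf{B}\otimes\mathbf{A})(\overline{r_1r_2},\overline{j_1j_2})=\mathbf{B}(r_2,j_2)\,\mathbf{A}(r_1,j_1)$. *)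

theory Defs
  imports Complex_Main "Jordan_Normal_Form.Matrix"
begin

text \<open>
  Third-order tensors with explicit dimensions, set up in the style of the type of matrices of
  \<open>Jordan_Normal_Form.Matrix\<close>: entries outside the index range have a fixed junk value, so that
  equality of tensors means equality of the three dimensions and of all entries.
  As for those matrices, indices start at 0: the index \<open>i\<close> here is the index \<open>i + 1\<close> of the
  1-based mathematical convention.
\<close>

definition mk_tensor3 ::
  "nat \<Rightarrow> nat \<Rightarrow> nat \<Rightarrow> (nat \<times> nat \<times> nat \<Rightarrow> 'a) \<Rightarrow> (nat \<times> nat \<times> nat \<Rightarrow> 'a)" where
  "mk_tensor3 P J Q f =
     (\<lambda>(p, j, q). if p < P \<and> j < J \<and> q < Q then f (p, j, q) else undefined)"

typedef 'a tensor3 =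
  "{(P, J, Q, mk_tensor3 P J Q f) | P J Q (f :: nat \<times> nat \<times> nat \<Rightarrow> 'a). True}"
  by blast

setup_lifting type_definition_tensor3

lift_definition dim1 :: "'a tensor3 \<Rightarrow> nat" is "\<lambda>(P, J, Q, f). P" .
lift_definition dim2 :: "'a tensor3 \<Rightarrow> nat" is "\<lambda>(P, J, Q, f). J" .
lift_definition dim3 :: "'a tensor3 \<Rightarrow> nat" is "\<lambda>(P, J, Q, f). Q" .

lift_definition tensor_index :: "'a tensor3 \<Rightarrow> nat \<times> nat \<times> nat \<Rightarrow> 'a" (infixl \<open>$$$\<close> 100)
  is "\<lambda>(P, J, Q, f). f" .

lift_definition tensor3 ::
  "nat \<Rightarrow> nat \<Rightarrow> nat \<Rightarrow> (nat \<times> nat \<times> nat \<Rightarrow> 'a) \<Rightarrow> 'a tensor3"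
  is "\<lambda>P J Q f. (P, J, Q, mk_tensor3 P J Q f)" by auto

definition carrier_tensor3 :: "nat \<Rightarrow> nat \<Rightarrow> nat \<Rightarrow> 'a tensor3 set" where
  "carrier_tensor3 P J Q = {X. dim1 X = P \<and> dim2 X = J \<and> dim3 X = Q}"

lemma dim_tensor3 [simp]:
  "dim1 (tensor3 P J Q f) = P" "dim2 (tensor3 P J Q f) = J" "dim3 (tensor3 P J Q f) = Q"
  by (transfer, simp)+

lemma index_tensor3 [simp]:
  "p < P \<Longrightarrow> j < J \<Longrightarrow> q < Q \<Longrightarrow> tensor3 P J Q f $$$ (p, j, q) = f (p, j, q)"
  by transfer (simp add: mk_tensor3_def)

lemma eq_tensor3I:
  assumes "dim1 X = dim1 Y" "dim2 X = dim2 Y" "dim3 X = dim3 Y"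
    and "\<And>p j q. p < dim1 Y \<Longrightarrow> j < dim2 Y \<Longrightarrow> q < dim3 Y \<Longrightarrow> X $$$ (p, j, q) = Y $$$ (p, j, q)"
  shows "X = Y"
  using assms by transfer (auto simp: mk_tensor3_def fun_eq_iff)

text \<open>The little-endian multi-index of a pair; the first range is \<open>{..<J1}\<close>. Its inverse on
  \<open>{..<J1 * J2}\<close> is \<open>j \<mapsto> (j mod J1, j div J1)\<close>.\<close>

definition multi_index :: "nat \<Rightarrow> nat \<Rightarrow> nat \<Rightarrow> nat" where
  "multi_index J1 j1 j2 = j1 + j2 * J1"

lemma multi_index_less:
  assumes "j1 < J1" "j2 < J2"
  shows "multi_index J1 j1 j2 < J1 * J2"
proof -
  have "multi_index J1 j1 j2 < Suc j2 * J1"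
    using assms(1) by (simp add: multi_index_def)
  also have "\<dots> \<le> J2 * J1"
    using assms(2) by (intro mult_le_mono1) simp
  finally show ?thesis by (simp add: mult.commute)
qed

lemma multi_index_inverse:
  "j1 < J1 \<Longrightarrow> multi_index J1 j1 j2 mod J1 = j1"
  "j1 < J1 \<Longrightarrow> multi_index J1 j1 j2 div J1 = j2"
  "multi_index J1 (j mod J1) (j div J1) = j"
  by (auto simp: multi_index_def)

definition lateral_slice :: "'a tensor3 \<Rightarrow> nat \<Rightarrow> 'a mat" where
  "lateral_slice X j = mat (dim1 X) (dim3 X) (\<lambda>(p, q). X $$$ (p, j, q))"

definition mode2_product :: "'a :: semiring_0 tensor3 \<Rightarrow> 'a mat \<Rightarrow> 'a tensor3"
    (infixl \<open>\<times>\<^sub>2\<close> 75) where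
  "X \<times>\<^sub>2 U = tensor3 (dim1 X) (dim_row U) (dim3 X)
     (\<lambda>(p, r, q). \<Sum>j < dim2 X. X $$$ (p, j, q) * U $$ (r, j))"

definition subchain_product :: "'a :: semiring_0 tensor3 \<Rightarrow> 'a tensor3 \<Rightarrow> 'a tensor3"
    (infixl \<open>\<boxtimes>\<^sub>2\<close> 70) where
  "X \<boxtimes>\<^sub>2 Y = tensor3 (dim1 X) (dim2 X * dim2 Y) (dim3 Y)
     (\<lambda>(p, j, q). (lateral_slice X (j mod dim2 X) * lateral_slice Y (j div dim2 X)) $$ (p, q))"

definition kronecker_product :: "'a :: semiring_0 mat \<Rightarrow> 'a mat \<Rightarrow> 'a mat"
    (infixl \<open>\<otimes>\<^sub>K\<close> 80) where
  "B \<otimes>\<^sub>K A = mat (dim_row B * dim_row A) (dim_col B * dim_col A)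
     (\<lambda>(r, j). B $$ (r div dim_row A, j div dim_col A) * A $$ (r mod dim_row A, j mod dim_col A))"

text \<open>The defining equations in terms of multi-indices.\<close>

lemma lateral_slice_subchain_product:
  assumes "j1 < dim2 X" "j2 < dim2 Y"
  shows "lateral_slice (X \<boxtimes>\<^sub>2 Y) (multi_index (dim2 X) j1 j2) =
         lateral_slice X j1 * lateral_slice Y j2"
  using assms multi_index_less[OF assms]
  by (intro eq_matI)
     (simp_all add: subchain_product_def lateral_slice_def multi_index_inverse)

lemma kronecker_product_index:
  assumes "A \<in> carrier_mat R1 J1" "B \<in> carrier_mat R2 J2"
    and "r1 < R1" "r2 < R2" "j1 < J1" "j2 < J2"
  shows "(B \<otimes>\<^sub>K A) $$ (multi_index R1 r1 r2, multi_index J1 j1 j2) = B $$ (r2, j2) * A $$ (r1, j1)"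
  using assms multi_index_less[of r1 R1 r2 R2] multi_index_less[of j1 J1 j2 J2]
  by (simp add: kronecker_product_def multi_index_inverse mult.commute)

end

theory Submission
  imports Defs
begin

text \<open>Both sides have the same dimensions, so entries are compared. Write a row index
  \<open>r\<close> as the multi-index of \<open>r1\<close>, \<open>r2\<close>. Entry
  \<open>(p, r, q)\<close> of either side is the sum over \<open>k\<close>, \<open>j1\<close>,
  \<open>j2\<close> of X(p,j1,k) Y(k,j2,q) B(r2,j2) A(r1,j1). On the left this comes from
  distributing a product of two sums inside the sum over \<open>k\<close>; on the right, from
  splitting the single summation index into its two digits, which is \<open>sum_mod_div\<close>.
  Finite sums over \<open>k\<close>, \<open>j1\<close>, \<open>j2\<close> may be
  interchanged.\<close>

lemma div_mod_less_mult:
  fixes j m n :: nat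
  assumes "j < m * n"
  shows "j mod m < m" "j div m < n"
  using assms by (auto simp: less_mult_imp_div_less mult.commute[of m] intro!: mod_less_divisor gr0I)

text \<open>\<open>multi_index m\<close> is a bijection from pairs of digits onto
  \<open>{..<m * n}\<close>, with inverse given by \<open>mod\<close> and
  \<open>div\<close>.\<close>

lemma sum_mod_div:
  fixes f :: "nat \<Rightarrow> nat \<Rightarrow> 'a :: comm_monoid_add"
  shows "(\<Sum>j < m * n. f (j mod m) (j div m)) = (\<Sum>j1 < m. \<Sum>j2 < n. f j1 j2)"
proof -
  have "(\<Sum>j < m * n. f (j mod m) (j div m)) = (\<Sum>(j1, j2) \<in> {..<m} \<times> {..<n}. f j1 j2)"
    by (rule sum.reindex_bij_witness[where i = "\<lambda>(j1, j2). multi_index m j1 j2"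
          and j = "\<lambda>j. (j mod m, j div m)"])
       (auto simp: multi_index_inverse multi_index_less div_mod_less_mult)
  then show ?thesis by (simp add: sum.cartesian_product)
qed

text \<open>Unfolds the product of slices into a sum over the shared dimension;
  \<open>dim3 X = dim1 Y\<close> keeps every \<open>k\<close> in range in both slices.\<close>

lemma subchain_product_index:
  assumes "dim3 X = dim1 Y" "p < dim1 X" "j < dim2 X * dim2 Y" "q < dim3 Y"
  shows "(X \<boxtimes>\<^sub>2 Y) $$$ (p, j, q) =
    (\<Sum>k < dim1 Y. X $$$ (p, j mod dim2 X, k) * Y $$$ (k, j div dim2 X, q))"
  using assms
  by (simp add: subchain_product_def lateral_slice_def scalar_prod_def atLeast0LessThan)

text \<open>Commutativity of the entries allows the factor from \<open>A\<close> to move past the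
  entry of \<open>Y\<close>.\<close>

lemma subchain_product_mode2_product:
  fixes X Y :: "'a :: comm_semiring_0 tensor3"
  assumes "dim3 X = dim1 Y" "dim_col A = dim2 X" "dim_col B = dim2 Y"
  shows "(X \<times>\<^sub>2 A) \<boxtimes>\<^sub>2 (Y \<times>\<^sub>2 B) = (X \<boxtimes>\<^sub>2 Y) \<times>\<^sub>2 (B \<otimes>\<^sub>K A)"
    (is "?L = ?R")
proof (rule eq_tensor3I)
  have dims: "dim1 ?R = dim1 X" "dim2 ?R = dim_row A * dim_row B" "dim3 ?R = dim3 Y"
    by (simp_all add: mode2_product_def subchain_product_def kronecker_product_def mult.commute)
  show "dim1 ?L = dim1 ?R" "dim2 ?L = dim2 ?R" "dim3 ?L = dim3 ?R"
    unfolding dims by (simp_all add: mode2_product_def subchain_product_def)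
  fix p r q
  assume "p < dim1 ?R" "r < dim2 ?R" "q < dim3 ?R"
  then have p: "p < dim1 X" and r: "r < dim_row A * dim_row B" and q: "q < dim3 Y"
    unfolding dims by auto
  \<comment> \<open>The subchain product on the left and the Kronecker product on the right split
    \<open>r\<close> in the same way, with base \<open>dim_row A\<close>.\<close>
  define r1 r2 where "r1 = r mod dim_row A" and "r2 = r div dim_row A"
  have r12: "r1 < dim_row A" "r2 < dim_row B"
    using div_mod_less_mult[OF r] by (auto simp: r1_def r2_def)
  let ?x = "\<lambda>j k. X $$$ (p, j, k)" and ?y = "\<lambda>j k. Y $$$ (k, j, q)"
  have "?L $$$ (p, r, q) = (\<Sum>k < dim1 Y. (X \<times>\<^sub>2 A) $$$ (p, r1, k) * (Y \<times>\<^sub>2 B) $$$ (k, r2, q))"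
    using assms p q r
    by (subst subchain_product_index) (simp_all add: mode2_product_def r1_def r2_def)
  also have "\<dots> = (\<Sum>k < dim1 Y. (\<Sum>j1 < dim2 X. ?x j1 k * A $$ (r1, j1)) *
                                (\<Sum>j2 < dim2 Y. ?y j2 k * B $$ (r2, j2)))"
    using assms p q r12 by (simp add: mode2_product_def)
  also have "\<dots> = (\<Sum>k < dim1 Y. \<Sum>j1 < dim2 X. \<Sum>j2 < dim2 Y.
                    ?x j1 k * ?y j2 k * (B $$ (r2, j2) * A $$ (r1, j1)))"
    by (simp add: sum_product mult_ac)
  also have "\<dots> = (\<Sum>j1 < dim2 X. \<Sum>j2 < dim2 Y. \<Sum>k < dim1 Y.
                    ?x j1 k * ?y j2 k * (B $$ (r2, j2) * A $$ (r1, j1)))"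
    \<comment> \<open>The sum over \<open>k\<close> moves inwards, first past \<open>j1\<close>,
      then past \<open>j2\<close> for fixed \<open>j1\<close>.\<close>
    by (rule trans[OF sum.swap], rule sum.cong[OF refl], rule sum.swap)
  also have "\<dots> = (\<Sum>j1 < dim2 X. \<Sum>j2 < dim2 Y.
                    (\<Sum>k < dim1 Y. ?x j1 k * ?y j2 k) * (B $$ (r2, j2) * A $$ (r1, j1)))"
    by (simp add: sum_distrib_right)
  also have "\<dots> = (\<Sum>j < dim2 X * dim2 Y.
                    (\<Sum>k < dim1 Y. ?x (j mod dim2 X) k * ?y (j div dim2 X) k) *
                    (B $$ (r2, j div dim2 X) * A $$ (r1, j mod dim2 X)))"
    by (rule sum_mod_div[symmetric])
  \<comment> \<open>Since \<open>dim_col A = dim2 X\<close>, the columns of the Kronecker product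
    and the slices of the subchain product use the same digits of \<open>j\<close>.\<close>
  also have "\<dots> = (\<Sum>j < dim2 X * dim2 Y. (X \<boxtimes>\<^sub>2 Y) $$$ (p, j, q) * (B \<otimes>\<^sub>K A) $$ (r, j))"
    using assms p q r
    by (intro sum.cong refl)
       (simp add: subchain_product_index kronecker_product_def r1_def r2_def mult.commute)
  also have "\<dots> = ?R $$$ (p, r, q)"
    using p q r
    by (simp add: mode2_product_def subchain_product_def kronecker_product_def mult.commute)
  finally show "?L $$$ (p, r, q) = ?R $$$ (p, r, q)" .
qed

theorem proposition3p2:
  fixes \<A> \<B> :: "real tensor3" and A B :: "real mat"
    and I1 I2 J1 J2 K R1 R2 :: nat
  assumes "I1 > 0" "I2 > 0" "J1 > 0" "J2 > 0" "K > 0" "R1 > 0" "R2 > 0"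
    and "\<A> \<in> carrier_tensor3 I1 J1 K"
    and "\<B> \<in> carrier_tensor3 K J2 I2"
    and "A \<in> carrier_mat R1 J1"
    and "B \<in> carrier_mat R2 J2"
  shows "(\<A> \<times>\<^sub>2 A) \<boxtimes>\<^sub>2 (\<B> \<times>\<^sub>2 B) = (\<A> \<boxtimes>\<^sub>2 \<B>) \<times>\<^sub>2 (B \<otimes>\<^sub>K A)"
  using assms by (intro subchain_product_mode2_product) (auto simp: carrier_tensor3_def)

end
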